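(* Let $G$ be a finite connected, non-complete strongly regular graph with parameters $(n,k,\lambda,\mu)$. If $\max(\lambda,\mu)\leq k/2$, or if $\lambda<k/2$, then $G$ admits a uniform avoidance coupling of two simple random walks.
   Context: A graph $G=(V,E)$ with $n$ vertices is strongly regular with parameters $(n,k,\lambda,\mu)$ (natural numbers $k,\lambda,\mu$, possibly zero) if every vertex has degree $k$, any two adjacent vertices have exactly $\lambda$ common neighbors, and any two distinct non-adjacent vertices have exactly $\mu$ common neighbors. A Markovian avoidance process of two tokens $X,Y$ on $V$ is a (time-homogeneous) Markov chain on $V\times V$ with transition probabilities $T[(x,y)\rightarrow(x',y')]$ and stationary distribution $s$, such that $s(v,v)=0$ for all $v\in V$, and whenever $s(v,w)>0$ one has $T[(v,w)\rightarrow(w,u)]=0$ for all $u\in V$ (the tokens move in turn, $X$ first). Writing $d(v)$ for the degree of $v$ and $\sim$ for adjacency, a uniform avoidance coupling of two simple random walks on $G$ is a Markovian avoidance process such that for every state $(x,y)$ with $s(x,y)>0$: $\sum_{y'}T[(x,y)\rightarrow(x',y')]$ equals $1/d(x)$ if $x'\sim x$ and $0$ otherwise, and $\sum_{x'}T[(x,y)\rightarrow(x',y')]$ equals $1/d(y)$ if $y'\sim y$ and $0$ otherwise. $G$ admits such a coupling if one exists. *)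

theory Defs
  imports "Graph_Theory.Graph_Theory" "HOL-Probability.Probability_Mass_Function"
begin

text \<open>
  A finite simple graph is a \<^verbatim>\<open>graph\<close> of Graph_Theory, i.e. a finite, loop-free, symmetric
  digraph without parallel arcs. An undirected edge is a pair of opposite arcs, so the degree
  of a vertex is its \<^verbatim>\<open>out_degree\<close>.
\<close>

definition common_neighbours :: "('a, 'b) pre_digraph \<Rightarrow> 'a \<Rightarrow> 'a \<Rightarrow> 'a set" where
  "common_neighbours G v w = {u \<in> verts G. v \<rightarrow>\<^bsub>G\<^esub> u \<and> w \<rightarrow>\<^bsub>G\<^esub> u}"

definition strongly_regular ::
  "('a, 'b) pre_digraph \<Rightarrow> nat \<Rightarrow> nat \<Rightarrow> nat \<Rightarrow> nat \<Rightarrow> bool" where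
  "strongly_regular G n k l m \<longleftrightarrow>
     card (verts G) = n \<and>
     (\<forall>v \<in> verts G. out_degree G v = k) \<and>
     (\<forall>v \<in> verts G. \<forall>w \<in> verts G.
        v \<rightarrow>\<^bsub>G\<^esub> w \<longrightarrow> card (common_neighbours G v w) = l) \<and>
     (\<forall>v \<in> verts G. \<forall>w \<in> verts G.
        v \<noteq> w \<and> \<not> v \<rightarrow>\<^bsub>G\<^esub> w \<longrightarrow> card (common_neighbours G v w) = m)"

text \<open>
  A time-homogeneous Markov chain is given by its transition kernel; values of the kernel
  outside the state space are irrelevant.
\<close>

definition markov_chain_on :: "'s set \<Rightarrow> ('s \<Rightarrow> 's pmf) \<Rightarrow> bool" where
  "markov_chain_on S T \<longleftrightarrow> (\<forall>p \<in> S. set_pmf (T p) \<subseteq> S)"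

definition stationary_distribution_on :: "'s set \<Rightarrow> ('s \<Rightarrow> 's pmf) \<Rightarrow> 's pmf \<Rightarrow> bool" where
  "stationary_distribution_on S T s \<longleftrightarrow> set_pmf s \<subseteq> S \<and> bind_pmf s T = s"

definition markovian_avoidance_process ::
  "'a set \<Rightarrow> ('a \<times> 'a \<Rightarrow> ('a \<times> 'a) pmf) \<Rightarrow> ('a \<times> 'a) pmf \<Rightarrow> bool" where
  "markovian_avoidance_process V T s \<longleftrightarrow>
     markov_chain_on (V \<times> V) T \<and>
     stationary_distribution_on (V \<times> V) T s \<and>
     (\<forall>v \<in> V. pmf s (v, v) = 0) \<and>
     (\<forall>v \<in> V. \<forall>w \<in> V. pmf s (v, w) > 0 \<longrightarrow> (\<forall>u \<in> V. pmf (T (v, w)) (w, u) = 0))"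

definition uniform_avoidance_coupling ::
  "('a, 'b) pre_digraph \<Rightarrow> ('a \<times> 'a \<Rightarrow> ('a \<times> 'a) pmf) \<Rightarrow> ('a \<times> 'a) pmf \<Rightarrow> bool" where
  "uniform_avoidance_coupling G T s \<longleftrightarrow>
     markovian_avoidance_process (verts G) T s \<and>
     (\<forall>x \<in> verts G. \<forall>y \<in> verts G. pmf s (x, y) > 0 \<longrightarrow>
        (\<forall>x' \<in> verts G. (\<Sum>y' \<in> verts G. pmf (T (x, y)) (x', y')) =
           (if x \<rightarrow>\<^bsub>G\<^esub> x' then 1 / real (out_degree G x) else 0)) \<and>
        (\<forall>y' \<in> verts G. (\<Sum>x' \<in> verts G. pmf (T (x, y)) (x', y')) =
           (if y \<rightarrow>\<^bsub>G\<^esub> y' then 1 / real (out_degree G y) else 0)))"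

definition admits_uniform_avoidance_coupling :: "('a, 'b) pre_digraph \<Rightarrow> bool" where
  "admits_uniform_avoidance_coupling G \<longleftrightarrow> (\<exists>T s. uniform_avoidance_coupling G T s)"

end

theory Submission
  imports Defs
begin

text \<open>
  The chain lives on the ordered pairs of distinct non-adjacent vertices. From such a pair
  \<open>(x, y)\<close>, move \<open>x\<close> to a uniform neighbour \<open>u\<close> and \<open>y\<close> to \<open>f u\<close>, where \<open>f\<close> is a bijection from the
  neighbours of \<open>x\<close> to those of \<open>y\<close> with \<open>u\<close> and \<open>f u\<close> always distinct and non-adjacent. By Hall's
  theorem, \<open>f\<close> exists unless there are \<open>S \<subseteq> N x\<close> and \<open>T \<subseteq> N y\<close> with \<open>card S + card T > k\<close> all of whose
  cross pairs are equal or adjacent. If \<open>S\<close> misses \<open>N y\<close>, then \<open>card S \<le> k - m\<close> and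
  \<open>card T \<le> m\<close>, and symmetrically for \<open>T\<close>; otherwise both sets have at most \<open>l + 1\<close> elements, and counting common
  neighbours excludes the few cases in which \<open>2 l \<le> k\<close> does not finish at once. A stationary
  distribution exists because the state space is finite.
\<close>

section \<open>Hall's marriage theorem\<close>

text \<open>Halmos-Vaughan induction: if a nonempty proper subset \<open>J\<close> is tight, match
  \<open>J\<close> first and the rest within what \<open>J\<close> leaves over; if none is tight,
  the surplus allows an arbitrary choice for one index.\<close>

lemma hall_marriage:
  assumes "finite I" "\<And>i. i \<in> I \<Longrightarrow> finite (A i)"
    and "\<And>J. J \<subseteq> I \<Longrightarrow> card J \<le> card (\<Union>(A ` J))"
  shows "\<exists>f. inj_on f I \<and> (\<forall>i\<in>I. f i \<in> A i)"
  using assms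
proof (induction I arbitrary: A rule: finite_psubset_induct)
  case (psubset I)
  note fin = \<open>finite I\<close> psubset.prems(1) and hall = psubset.prems(2)
  have finJ: "finite (\<Union>(A ` J))" if "J \<subseteq> I" for J
    using that fin by (meson finite_UN finite_subset subsetD)
  consider "I = {}"
    | J where "J \<subset> I" "J \<noteq> {}" "card (\<Union>(A ` J)) = card J"
    | "I \<noteq> {}" "\<And>J. J \<subset> I \<Longrightarrow> J \<noteq> {} \<Longrightarrow> card J < card (\<Union>(A ` J))"
    using hall by (metis le_neq_implies_less psubset_imp_subset)
  then show ?case
  proof cases
    case 1
    then show ?thesis by simp
  next
    case (2 J)
    have "\<exists>f. inj_on f J \<and> (\<forall>i\<in>J. f i \<in> A i)"
    proof (rule psubset.IH[OF \<open>J \<subset> I\<close>])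
      show "finite (A i)" if "i \<in> J" for i
        using that 2(1) fin(2) by blast
      show "card K \<le> card (\<Union>(A ` K))" if "K \<subseteq> J" for K
        using that 2(1) hall by blast
    qed
    then obtain f where f: "inj_on f J" "\<forall>i\<in>J. f i \<in> A i" by blast
    define B where "B i = A i - \<Union>(A ` J)" for i
    have "\<exists>g. inj_on g (I - J) \<and> (\<forall>i\<in>I - J. g i \<in> B i)"
    proof (rule psubset.IH)
      show "I - J \<subset> I" using 2 by blast
      show "finite (B i)" if "i \<in> I - J" for i using that fin(2) by (simp add: B_def)
      show "card K \<le> card (\<Union>(B ` K))" if K: "K \<subseteq> I - J" for K
      proof -
        have "K \<union> J \<subseteq> I" using K 2 by blast
        \<comment> \<open>Hall's condition for \<open>K\<close> with the reduced sets is the one for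
          \<open>K \<union> J\<close> minus the tight contribution of \<open>J\<close>.\<close>
        have "card K + card J = card (K \<union> J)"
          using K 2 fin(1) by (intro card_Un_disjoint[symmetric]) (auto intro: finite_subset)
        also have "\<dots> \<le> card (\<Union>(A ` (K \<union> J)))"
          using hall \<open>K \<union> J \<subseteq> I\<close> by blast
        also have "\<Union>(A ` (K \<union> J)) = \<Union>(B ` K) \<union> \<Union>(A ` J)"
          by (auto simp: B_def)
        also have "card \<dots> \<le> card (\<Union>(B ` K)) + card (\<Union>(A ` J))"
          by (rule card_Un_le)
        finally show ?thesis using 2 by simp
      qed
    qed
    then obtain g where g: "inj_on g (I - J)" "\<forall>i\<in>I - J. g i \<in> B i" by blast
    have "inj_on (\<lambda>i. if i \<in> J then f i else g i) I"
    proof (rule inj_onI)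
      fix i j assume ij: "i \<in> I" "j \<in> I" and eq: "(if i \<in> J then f i else g i) = (if j \<in> J then f j else g j)"
      have *: "f a \<noteq> g b" if "a \<in> J" "b \<in> I" "b \<notin> J" for a b
        using that f(2) g(2) unfolding B_def by fastforce
      show "i = j"
        using ij eq f(1) g(1) *[of i j] *[of j i] by (auto split: if_splits dest: inj_onD)
    qed
    moreover have "\<forall>i\<in>I. (if i \<in> J then f i else g i) \<in> A i"
      using f(2) g(2) by (auto simp: B_def)
    ultimately show ?thesis by blast
  next
    case 3
    then obtain i where i: "i \<in> I" by blast
    have "card {i} \<le> card (\<Union>(A ` {i}))" using i by (intro hall) auto
    then obtain a where a: "a \<in> A i" by fastforce
    have "\<exists>g. inj_on g (I - {i}) \<and> (\<forall>j\<in>I - {i}. g j \<in> A j - {a})"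
    proof (rule psubset.IH)
      show "I - {i} \<subset> I" using i by blast
      show "finite (A j - {a})" if "j \<in> I - {i}" for j using that fin(2) by simp
      show "card K \<le> card (\<Union>j\<in>K. A j - {a})" if K: "K \<subseteq> I - {i}" for K
      proof (cases "K = {}")
        case False
        \<comment> \<open>Strictness absorbs the loss of \<open>a\<close>.\<close>
        have "card K < card (\<Union>(A ` K))" using 3(2) False K i by blast
        also have "\<dots> \<le> Suc (card (\<Union>(A ` K) - {a}))"
          using K by (metis card_Suc_Diff1 card_Diff_singleton_if finJ Diff_subset le_SucI order_refl subset_trans)
        also have "\<Union>(A ` K) - {a} = (\<Union>j\<in>K. A j - {a})" by blast
        finally show ?thesis by simp
      qed simp
    qed
    then obtain g where g: "inj_on g (I - {i})" "\<forall>j\<in>I - {i}. g j \<in> A j - {a}" by blast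
    have "inj_on (g(i := a)) I"
      using g by (auto simp: inj_on_def)
    moreover have "\<forall>j\<in>I. (g(i := a)) j \<in> A j"
      using g(2) a by auto
    ultimately show ?thesis by blast
  qed
qed

section \<open>Stationary distributions of finite chains\<close>

text \<open>
  State elimination: removing the state \<open>z\<close> gives the chain watched only while it is outside \<open>z\<close>,
  with transition probabilities \<open>P i j + P i z * P z j / (1 - P z z)\<close>.
\<close>

lemma stochastic_matrix_invariant_vector:
  fixes P :: "'s \<Rightarrow> 's \<Rightarrow> real"
  assumes "finite S" "S \<noteq> {}"
    and "\<And>i j. i \<in> S \<Longrightarrow> j \<in> S \<Longrightarrow> P i j \<ge> 0"
    and "\<And>i. i \<in> S \<Longrightarrow> (\<Sum>j\<in>S. P i j) = 1"
  shows "\<exists>s. (\<forall>i\<in>S. s i \<ge> 0) \<and> (\<Sum>i\<in>S. s i) > 0 \<and> (\<forall>j\<in>S. (\<Sum>i\<in>S. s i * P i j) = s j)"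
  using assms
proof (induction S arbitrary: P rule: finite_ne_induct)
  case (singleton z)
  then show ?case by (intro exI[of _ "\<lambda>_. 1"]) simp
next
  case (insert z F)
  note nn = insert.prems(1) and row = insert.prems(2)
  have rowz: "P z z + (\<Sum>j\<in>F. P z j) = 1"
    using row[of z] insert.hyps by simp
  have row': "P i z + (\<Sum>j\<in>F. P i j) = 1" if "i \<in> F" for i
    using row[of i] insert.hyps that by simp
  show ?case
  proof (cases "P z z = 1")
    case True
    \<comment> \<open>Here \<open>z\<close> is absorbing, so the point mass at \<open>z\<close> is
      invariant.\<close>
    then have "\<forall>j\<in>F. P z j = 0"
      using rowz nn insert.hyps by (simp add: sum_nonneg_eq_0_iff)
    then show ?thesis
      using True insert.hyps by (intro exI[of _ "\<lambda>i. if i = z then 1 else 0"]) (auto simp: if_distrib[of "\<lambda>t. t * _"] cong: if_cong)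
  next
    case False
    define c where "c = 1 - P z z"
    have "(\<Sum>j\<in>F. P z j) \<ge> 0" using nn by (intro sum_nonneg) auto
    then have c: "c > 0" "(\<Sum>j\<in>F. P z j) = c"
      using rowz False by (auto simp: c_def)
    define Q where "Q i j = P i j + P i z * P z j / c" for i j
    have "\<exists>s. (\<forall>i\<in>F. s i \<ge> 0) \<and> (\<Sum>i\<in>F. s i) > 0 \<and> (\<forall>j\<in>F. (\<Sum>i\<in>F. s i * Q i j) = s j)"
    proof (rule insert.IH)
      show "Q i j \<ge> 0" if "i \<in> F" "j \<in> F" for i j
        using that nn c by (simp add: Q_def)
      show "(\<Sum>j\<in>F. Q i j) = 1" if "i \<in> F" for i
      proof -
        have "(\<Sum>j\<in>F. Q i j) = (\<Sum>j\<in>F. P i j) + P i z * (\<Sum>j\<in>F. P z j) / c"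
          by (simp add: Q_def sum.distrib sum_distrib_left sum_divide_distrib)
        then show ?thesis using c row'[OF that] by simp
      qed
    qed
    then obtain s where s: "\<forall>i\<in>F. s i \<ge> 0" "(\<Sum>i\<in>F. s i) > 0"
      "\<And>j. j \<in> F \<Longrightarrow> (\<Sum>i\<in>F. s i * Q i j) = s j" by blast
    \<comment> \<open>The balance equation at \<open>z\<close> forces this value as the weight of
      \<open>z\<close>.\<close>
    define r where "r = (\<Sum>i\<in>F. s i * P i z) / c"
    have r: "r \<ge> 0"
      unfolding r_def using s(1) nn c by (intro divide_nonneg_pos sum_nonneg) auto
    have rz: "(\<Sum>i\<in>F. s i * P i z) + r * P z z = r"
      using c by (simp add: r_def c_def field_simps)
    have rF: "(\<Sum>i\<in>F. s i * P i j) + r * P z j = s j" if "j \<in> F" for j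
    proof -
      have "s j = (\<Sum>i\<in>F. s i * Q i j)" using s(3)[OF that] by simp
      also have "\<dots> = (\<Sum>i\<in>F. s i * P i j + s i * P i z * (P z j / c))"
        by (intro sum.cong) (auto simp: Q_def algebra_simps)
      also have "\<dots> = (\<Sum>i\<in>F. s i * P i j) + r * P z j"
        by (simp only: r_def sum.distrib sum_distrib_right[symmetric]) simp
      finally show ?thesis by simp
    qed
    have upd: "(\<Sum>i\<in>F. (s(z := r)) i * P i j) = (\<Sum>i\<in>F. s i * P i j)" for j
      using insert.hyps by (intro sum.cong) auto
    have upd': "(\<Sum>i\<in>F. (s(z := r)) i) = (\<Sum>i\<in>F. s i)"
      using insert.hyps by (intro sum.cong) auto
    have "\<forall>i\<in>insert z F. (s(z := r)) i \<ge> 0" using s(1) r by simp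
    moreover have "(\<Sum>i\<in>insert z F. (s(z := r)) i) > 0"
      using insert.hyps upd' r s(2) by (subst sum.insert) (auto simp del: fun_upd_apply, simp)
    moreover have "\<forall>j\<in>insert z F. (\<Sum>i\<in>insert z F. (s(z := r)) i * P i j) = (s(z := r)) j"
    proof
      fix j assume j: "j \<in> insert z F"
      have "(\<Sum>i\<in>insert z F. (s(z := r)) i * P i j) = r * P z j + (\<Sum>i\<in>F. s i * P i j)"
        using insert.hyps upd by (subst sum.insert) (simp_all del: fun_upd_apply, simp)
      then show "(\<Sum>i\<in>insert z F. (s(z := r)) i * P i j) = (s(z := r)) j"
        using rz rF[of j] j by (auto simp: add.commute)
    qed
    ultimately show ?thesis by blast
  qed
qed

lemma stationary_distribution_on_exists:
  fixes T :: "'s \<Rightarrow> 's pmf"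
  assumes "finite S" "S \<noteq> {}" "markov_chain_on S T"
  shows "\<exists>s. stationary_distribution_on S T s"
proof -
  have sub: "set_pmf (T i) \<subseteq> S" if "i \<in> S" for i
    using assms(3) that by (auto simp: markov_chain_on_def)
  have "\<exists>s. (\<forall>i\<in>S. s i \<ge> 0) \<and> (\<Sum>i\<in>S. s i) > 0 \<and> (\<forall>j\<in>S. (\<Sum>i\<in>S. s i * pmf (T i) j) = s j)"
    using assms(1,2) sub by (intro stochastic_matrix_invariant_vector) (auto simp: sum_pmf_eq_1)
  then obtain s where s: "\<forall>i\<in>S. s i \<ge> 0" "(\<Sum>i\<in>S. s i) > 0"
    "\<And>j. j \<in> S \<Longrightarrow> (\<Sum>i\<in>S. s i * pmf (T i) j) = s j" by blast
  \<comment> \<open>Normalised, and extended by 0 because \<open>embed_pmf\<close> takes a density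
    on the whole type.\<close>
  define w where "w i = (if i \<in> S then s i / (\<Sum>i\<in>S. s i) else 0)" for i
  have w0: "w i \<ge> 0" for i using s by (simp add: w_def)
  have w1: "(\<Sum>i\<in>S. w i) = 1"
    using s(2) by (simp add: w_def flip: sum_divide_distrib)
  have "(\<integral>\<^sup>+i. ennreal (w i) \<partial>count_space UNIV) = (\<integral>\<^sup>+i. ennreal (w i) \<partial>count_space S)"
    by (intro nn_integral_count_space_eq) (auto simp: w_def)
  also have "\<dots> = (\<Sum>i\<in>S. ennreal (w i))"
    by (rule nn_integral_count_space_finite[OF assms(1)])
  also have "\<dots> = 1" using w0 w1 by (simp add: sum_ennreal)
  finally have int: "(\<integral>\<^sup>+i. ennreal (w i) \<partial>count_space UNIV) = 1" .
  have pmf: "pmf (embed_pmf w) i = w i" for i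
    by (rule pmf_embed_pmf[OF w0 int])
  have set: "set_pmf (embed_pmf w) \<subseteq> S"
    by (auto simp: set_pmf_iff pmf w_def split: if_splits)
  have "bind_pmf (embed_pmf w) T = embed_pmf w"
  proof (rule pmf_eqI)
    fix j
    have "pmf (bind_pmf (embed_pmf w) T) j = (\<Sum>i\<in>S. pmf (T i) j * w i)"
      unfolding pmf_bind using set assms(1) by (subst integral_measure_pmf_real[of S]) (auto simp: pmf)
    also have "\<dots> = w j"
    proof (cases "j \<in> S")
      case True
      have "(\<Sum>i\<in>S. pmf (T i) j * w i) = (\<Sum>i\<in>S. s i * pmf (T i) j) / (\<Sum>i\<in>S. s i)"
        unfolding sum_divide_distrib by (intro sum.cong) (auto simp: w_def)
      then show ?thesis using s(3) True by (simp add: w_def)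
    next
      case False
      then have "pmf (T i) j = 0" if "i \<in> S" for i
        using sub[OF that] by (auto simp: pmf_eq_0_set_pmf)
      then show ?thesis using False by (simp add: w_def)
    qed
    finally show "pmf (bind_pmf (embed_pmf w) T) j = pmf (embed_pmf w) j" by (simp add: pmf)
  qed
  with set show ?thesis by (auto simp: stationary_distribution_on_def)
qed

section \<open>Marginals of a joint distribution\<close>

text \<open>Turns the finite sums in the coupling conditions into marginals, which
  \<open>map_pmf\<close> computes.\<close>

lemma sum_pmf_fst:
  assumes "finite V" "set_pmf P \<subseteq> U \<times> V"
  shows "(\<Sum>y\<in>V. pmf P (x, y)) = pmf (map_pmf fst P) x"
proof -
  have "pmf (map_pmf fst P) x = measure_pmf.prob P ((fst -` {x}) \<inter> set_pmf P)"
    by (simp add: pmf_map measure_Int_set_pmf)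
  also have "\<dots> = measure_pmf.prob P (({x} \<times> V) \<inter> set_pmf P)"
    using assms(2) by (intro arg_cong[of _ _ "measure_pmf.prob P"]) auto
  also have "\<dots> = sum (pmf P) ({x} \<times> V)"
    using assms(1) by (simp add: measure_Int_set_pmf measure_measure_pmf_finite)
  also have "\<dots> = (\<Sum>y\<in>V. pmf P (x, y))"
    by (intro sum.reindex_bij_witness[of _ "Pair x" snd]) auto
  finally show ?thesis by simp
qed

lemma sum_pmf_snd:
  assumes "finite U" "set_pmf P \<subseteq> U \<times> V"
  shows "(\<Sum>x\<in>U. pmf P (x, y)) = pmf (map_pmf snd P) y"
proof -
  have "(\<Sum>x\<in>U. pmf P (x, y)) = (\<Sum>x\<in>U. pmf (map_pmf prod.swap P) (y, x))"
    by (intro sum.cong refl) (metis inj_swap pmf_map_inj' swap_simp)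
  also have "\<dots> = pmf (map_pmf fst (map_pmf prod.swap P)) y"
    using assms by (intro sum_pmf_fst[of _ _ V]) auto
  finally show ?thesis by (simp add: map_pmf_comp)
qed


section \<open>Counting in neighbourhoods of a strongly regular graph\<close>

locale srg_neighbourhoods =
  fixes V :: "'a set" and N :: "'a \<Rightarrow> 'a set" and k l m :: nat
  assumes fin_V: "finite V"
    and N_subset: "N v \<subseteq> V"
    and N_sym: "u \<in> N v \<Longrightarrow> v \<in> N u"
    and N_irrefl: "v \<notin> N v"
    and card_N: "v \<in> V \<Longrightarrow> card (N v) = k"
    and card_N_adj: "v \<in> V \<Longrightarrow> w \<in> N v \<Longrightarrow> card (N v \<inter> N w) = l"
    and card_N_nonadj: "v \<in> V \<Longrightarrow> w \<in> V \<Longrightarrow> v \<noteq> w \<Longrightarrow> w \<notin> N v \<Longrightarrow> card (N v \<inter> N w) = m"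
begin

lemma finite_N [simp]: "finite (N v)"
  using fin_V N_subset finite_subset by blast

text \<open>The obstruction to Hall's condition: no vertex of \<open>S\<close> may be matched with a
  vertex of \<open>T\<close>.\<close>

definition blocked :: "'a \<Rightarrow> 'a \<Rightarrow> 'a set \<Rightarrow> 'a set \<Rightarrow> bool" where
  "blocked x y S T \<longleftrightarrow> x \<in> V \<and> y \<in> V \<and> x \<noteq> y \<and> y \<notin> N x \<and> S \<subseteq> N x \<and> T \<subseteq> N y \<and>
     (\<forall>s\<in>S. \<forall>t\<in>T. s = t \<or> s \<in> N t)"

lemma blocked_sym: "blocked x y S T \<Longrightarrow> blocked y x T S"
  unfolding blocked_def by (metis N_sym)

lemma blockedD:
  assumes "blocked x y S T" "s \<in> S" "t \<in> T"
  shows "s \<noteq> t \<Longrightarrow> t \<in> N s" "s \<noteq> t \<Longrightarrow> s \<in> N t"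
  using assms N_sym unfolding blocked_def by metis+

lemma blocked_baseD:
  assumes "blocked x y S T"
  shows "s \<in> S \<Longrightarrow> x \<in> N s" "t \<in> T \<Longrightarrow> y \<in> N t" "x \<notin> T" "y \<notin> T"
  using assms N_sym N_irrefl unfolding blocked_def by (metis subsetD)+

lemma blocked_finite:
  assumes "blocked x y S T"
  shows "finite S" "finite T"
  using assms finite_subset[OF _ finite_N] unfolding blocked_def by blast+

text \<open>Any \<open>s\<close> in \<open>S\<close> is non-adjacent to \<open>y\<close>, so
  \<open>T\<close> lies among the \<open>m\<close> common neighbours of \<open>s\<close> and
  \<open>y\<close>, while \<open>S\<close> avoids the \<open>m\<close> common neighbours of
  \<open>x\<close> and \<open>y\<close>.\<close>

lemma blocked_card_disjoint:
  assumes b: "blocked x y S T" and S: "S \<noteq> {}" "S \<inter> N y = {}"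
  shows "card S + card T \<le> k"
proof -
  note B = b[unfolded blocked_def]
  obtain s where s: "s \<in> S" using S by blast
  have m: "card (N x \<inter> N y) = m" using B card_N_nonadj by blast
  have "T \<subseteq> N s \<inter> N y" using B s S(2) blockedD(1)[OF b s] by blast
  moreover have "card (N s \<inter> N y) = m"
  proof (rule card_N_nonadj)
    show "s \<in> V" "y \<in> V" using B s N_subset by blast+
    show "s \<noteq> y" using B s by blast
    show "y \<notin> N s" using s S(2) N_sym[of y s] by blast
  qed
  ultimately have T: "card T \<le> m" by (metis card_mono finite_Int finite_N)
  have "card S \<le> card (N x - N y)" using B S(2) by (intro card_mono) auto
  also have "\<dots> = k - m"
    using B m card_N by (simp add: card_Diff_subset_Int)
  finally have "card S \<le> k - m" .
  moreover have "m \<le> k"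
    using B m card_N by (metis card_mono finite_N inf_le1)
  ultimately show ?thesis using T by simp
qed

text \<open>All of \<open>T\<close> except possibly \<open>c\<close> consists of common neighbours
  of the adjacent vertices \<open>c\<close> and \<open>y\<close>.\<close>

lemma blocked_card_le:
  assumes b: "blocked x y S T" and c: "c \<in> S" "c \<in> N y"
  shows "card (T - {c}) \<le> l"
proof -
  note B = b[unfolded blocked_def]
  have "T - {c} \<subseteq> N y \<inter> N c" using B blockedD(1)[OF b c(1)] by blast
  moreover have "card (N y \<inter> N c) = l" using B c card_N_adj by blast
  ultimately show ?thesis by (metis card_mono finite_Int finite_N)
qed

text \<open>
  In the extremal case \<open>T\<close> is \<open>c\<close> together with all common neighbours of \<open>c\<close> and \<open>y\<close>; a second
  element \<open>w\<close> of \<open>S\<close> would then share with \<open>c\<close> almost all of \<open>T\<close> and in addition \<open>x\<close>, which is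
  more than \<open>l\<close> vertices.
\<close>

lemma blocked_card_extremal:
  assumes b: "blocked x y S T" and c: "c \<in> S" "c \<in> N y" and T: "card T = Suc l"
  shows "card S + card T \<le> k"
proof -
  note B = b[unfolded blocked_def] and finT = blocked_finite(2)[OF b]
  have "c \<in> T"
    using blocked_card_le[OF b c] T by (cases "c \<in> T") auto
  note xyT = blocked_baseD(3,4)[OF b]
  have xy: "x \<in> N c" "y \<in> N c" "x \<noteq> y"
    using B c(1) \<open>c \<in> T\<close> blocked_baseD(1,2)[OF b] by blast+
  have cV: "c \<in> V" using c N_subset by blast
  have Tc: "T - {c} \<subseteq> N c" using blockedD(1)[OF b c(1)] by blast
  show ?thesis
  proof (cases "S = {c}")
    case True
    \<comment> \<open>The vertices \<open>x\<close>, \<open>y\<close> and the \<open>l\<close>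
      elements of \<open>T - {c}\<close> are distinct neighbours of \<open>c\<close>, so
      \<open>l + 2 \<le> k\<close>.\<close>
    have "card (insert x (insert y (T - {c}))) \<le> card (N c)"
      using xy Tc by (intro card_mono) auto
    then show ?thesis
      using True xyT xy T finT \<open>c \<in> T\<close> card_N[OF cV] by simp
  next
    case False
    then obtain w where w: "w \<in> S" "w \<noteq> c" using c by blast
    have wc: "w \<in> N c" using blockedD(2)[OF b w(1) \<open>c \<in> T\<close>] w(2) by blast
    have xw: "x \<in> N w" using blocked_baseD(1)[OF b w(1)] .
    have com: "T - {c, w} \<subseteq> N c \<inter> N w" using Tc blockedD(1)[OF b w(1)] by blast
    have "Suc l \<le> card (N c \<inter> N w)"
    proof (cases "w \<in> T")
      case True
      \<comment> \<open>The extra common neighbour \<open>y\<close> makes up for \<open>w\<close>,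
        which drops out of the count.\<close>
      then have "y \<in> N w" by (rule blocked_baseD(2)[OF b])
      then have "card (insert x (insert y (T - {c, w}))) \<le> card (N c \<inter> N w)"
        using xy xw com by (intro card_mono) auto
      moreover have "card (T - {c, w}) = Suc l - 2"
        using True \<open>c \<in> T\<close> w T by (subst card_Diff_subset) auto
      \<comment> \<open>Ensures that the subtraction in \<open>Suc l - 2\<close> does not
        truncate.\<close>
      moreover have "card {c, w} \<le> card T"
        using True \<open>c \<in> T\<close> finT by (intro card_mono) auto
      ultimately show ?thesis using xyT xy(3) finT T w by simp
    next
      case False
      have "card (insert x (T - {c, w})) \<le> card (N c \<inter> N w)"
        using xy xw com by (intro card_mono) auto
      moreover have "T - {c, w} = T - {c}" using False by blast
      ultimately show ?thesis using xyT finT T \<open>c \<in> T\<close> by simp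
    qed
    then show ?thesis using card_N_adj[OF cV wc] by simp
  qed
qed

text \<open>If each set meets the other base vertex's neighbourhood, both have at most
  \<open>l + 1\<close> elements. Size \<open>l + 1\<close> is the extremal case; otherwise
  \<open>2 * l \<le> k\<close> suffices.\<close>

lemma blocked_card:
  assumes l: "2 * l \<le> k" and b: "blocked x y S T"
  shows "card S + card T \<le> k"
proof -
  note B = b[unfolded blocked_def] and b' = blocked_sym[OF b]
  have small: "card S \<le> k" "card T \<le> k"
    using B card_N by (metis card_mono finite_N)+
  consider "S = {}" | "T = {}" | "S \<noteq> {}" "S \<inter> N y = {}" | "T \<noteq> {}" "T \<inter> N x = {}"
    | c d where "c \<in> S" "c \<in> N y" "d \<in> T" "d \<in> N x" by blast
  then show ?thesis
  proof cases
    case 5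
    have le: "card T \<le> Suc l" "card S \<le> Suc l"
      using blocked_card_le[OF b 5(1,2)] blocked_card_le[OF b' 5(3,4)]
      by (metis card_Diff1_le card_Diff_singleton_if diff_le_self le_SucI le_diff_conv Suc_eq_plus1)+
    consider "card T = Suc l" | "card S = Suc l" | "card T \<le> l" "card S \<le> l"
      using le by linarith
    then show ?thesis
      using blocked_card_extremal[OF b 5(1,2)] blocked_card_extremal[OF b' 5(3,4)] l
      by cases auto
  qed (use small blocked_card_disjoint[OF b] blocked_card_disjoint[OF b'] in auto)
qed

text \<open>For \<open>J \<subseteq> N x\<close>, the vertices of \<open>N y\<close> allowed for no
  element of \<open>J\<close> form a blocked pair with \<open>J\<close>; its size bound is Hall's
  condition. Equal degrees make the injection onto.\<close>

lemma avoiding_bijection: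
  assumes l: "2 * l \<le> k" and xy: "x \<in> V" "y \<in> V" "x \<noteq> y" "y \<notin> N x"
  shows "\<exists>f. bij_betw f (N x) (N y) \<and> (\<forall>u\<in>N x. f u \<noteq> u \<and> f u \<notin> N u)"
proof -
  define A where "A u = N y - insert u (N u)" for u
  have "\<exists>f. inj_on f (N x) \<and> (\<forall>u\<in>N x. f u \<in> A u)"
  proof (rule hall_marriage)
    show "card J \<le> card (\<Union>(A ` J))" if J: "J \<subseteq> N x" for J
    proof -
      have sub: "\<Union>(A ` J) \<subseteq> N y" by (auto simp: A_def)
      have "s = t \<or> s \<in> N t" if "s \<in> J" "t \<in> N y - \<Union>(A ` J)" for s t
        using that N_sym[of t s] by (auto simp: A_def)
      then have "blocked x y J (N y - \<Union>(A ` J))"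
        unfolding blocked_def using xy J by blast
      then have "card J + card (N y - \<Union>(A ` J)) \<le> k" by (rule blocked_card[OF l])
      moreover have "card (N y - \<Union>(A ` J)) = k - card (\<Union>(A ` J))"
        using sub card_N[OF xy(2)] by (metis card_Diff_subset finite_N finite_subset)
      moreover have "card (\<Union>(A ` J)) \<le> k"
        using sub card_N[OF xy(2)] by (metis card_mono finite_N)
      ultimately show ?thesis by linarith
    qed
  qed (simp_all add: A_def)
  then obtain f where f: "inj_on f (N x)" "\<forall>u\<in>N x. f u \<in> A u" by blast
  have "f ` N x = N y"
    using f card_N[OF xy(1)] card_N[OF xy(2)]
    by (intro card_subset_eq) (auto simp: A_def card_image)
  then show ?thesis using f by (auto simp: bij_betw_def A_def)
qed

end

section \<open>From arcs to neighbourhoods\<close>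

lemma (in nomulti_digraph) out_degree_eq_card:
  "out_degree G v = card {u \<in> verts G. v \<rightarrow>\<^bsub>G\<^esub> u}"
proof -
  have "inj_on (head G) (out_arcs G v)"
    by (rule inj_onI) (auto intro!: no_multi_arcs simp: arc_to_ends_def)
  moreover have "head G ` out_arcs G v = {u \<in> verts G. v \<rightarrow>\<^bsub>G\<^esub> u}"
    by (auto simp: arcs_ends_conv)
  ultimately show ?thesis
    unfolding out_degree_def by (metis card_image)
qed

lemma (in graph) strongly_regular_imp_srg_neighbourhoods:
  assumes "strongly_regular G n k l m"
  shows "srg_neighbourhoods (verts G) (\<lambda>v. {u \<in> verts G. v \<rightarrow>\<^bsub>G\<^esub> u}) k l m"
proof -
  have common: "common_neighbours G v w = {u \<in> verts G. v \<rightarrow>\<^bsub>G\<^esub> u} \<inter> {u \<in> verts G. w \<rightarrow>\<^bsub>G\<^esub> u}" for v w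
    by (auto simp: common_neighbours_def)
  show ?thesis
    using assms unfolding strongly_regular_def common out_degree_eq_card
    by unfold_locales (auto intro: arcs_ends_symmetric[OF sym_arcs] adj_in_verts dest: adj_not_same)
qed

section \<open>Construction of the coupling\<close>

theorem corollary8p11:
  fixes G :: "('a, 'b) pre_digraph" and n k l m :: nat
  assumes "graph G"
    and "Digraph_Component.connected G"
    and "\<not> complete_digraph n G"
    and "strongly_regular G n k l m"
    and "real (max l m) \<le> real k / 2 \<or> real l < real k / 2"
  shows "admits_uniform_avoidance_coupling G"
proof -
  interpret graph G by fact
  let ?V = "verts G"
  define N where "N v = {u \<in> ?V. v \<rightarrow>\<^bsub>G\<^esub> u}" for v
  interpret srg_neighbourhoods ?V N k l m
    unfolding N_def by (rule strongly_regular_imp_srg_neighbourhoods) fact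
  have l: "2 * l \<le> k" using assms(5) by auto
  have deg: "out_degree G v = k" if "v \<in> ?V" for v
    using assms(4) that by (simp add: strongly_regular_def)
  define D where "D = {(x, y) \<in> ?V \<times> ?V. x \<noteq> y \<and> y \<notin> N x}"
  have finD: "finite D" by (rule finite_subset[of _ "?V \<times> ?V"]) (auto simp: D_def)
  \<comment> \<open>Non-completeness makes the state space \<open>D\<close> nonempty.\<close>
  have "card ?V = n" using assms(4) by (simp add: strongly_regular_def)
  then have "arcs_ends G \<noteq> {(u, v). (u, v) \<in> ?V \<times> ?V \<and> u \<noteq> v}"
    using assms(1,3) by (auto simp: complete_digraph_def)
  moreover have "arcs_ends G \<subseteq> {(u, v). (u, v) \<in> ?V \<times> ?V \<and> u \<noteq> v}"
    using adj_in_verts adj_not_same by auto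
  ultimately obtain a b where ab: "(a, b) \<in> D"
    unfolding D_def N_def by auto
  have "strongly_connected G"
    using symmetric_connected_imp_strongly_connected[OF sym_arcs assms(2)] .
  then have "a \<rightarrow>\<^sup>*\<^bsub>G\<^esub> b" using ab by (auto simp: D_def)
  \<comment> \<open>A path from \<open>a\<close> to \<open>b \<noteq> a\<close> has a first arc, so
    degrees are positive and uniform moves exist.\<close>
  then obtain w where "a \<rightarrow>\<^bsub>G\<^esub> w"
    using ab by (cases rule: converse_reachable_cases) (auto simp: D_def)
  then have "w \<in> N a" using adj_in_verts by (auto simp: N_def)
  then have "k > 0" using card_N[of a] ab by (auto simp: D_def card_gt_0_iff)
  then have N_ne: "N v \<noteq> {}" if "v \<in> ?V" for v using card_N[OF that] by auto

  have "\<exists>f. bij_betw f (N (fst p)) (N (snd p)) \<and> (\<forall>u\<in>N (fst p). f u \<noteq> u \<and> f u \<notin> N u)"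
    if "p \<in> D" for p
    using that by (intro avoiding_bijection[OF l]) (auto simp: D_def)
  then obtain F where F: "\<And>p. p \<in> D \<Longrightarrow> bij_betw (F p) (N (fst p)) (N (snd p)) \<and>
      (\<forall>u\<in>N (fst p). F p u \<noteq> u \<and> F p u \<notin> N u)"
    by metis
  \<comment> \<open>Off \<open>D\<close> the chain stays put, so it remains a chain on all pairs of
    vertices.\<close>
  define T where "T p = (if p \<in> D then map_pmf (\<lambda>u. (u, F p u)) (pmf_of_set (N (fst p)))
    else return_pmf p)" for p
  have T_support: "set_pmf (T p) \<subseteq> D" if "p \<in> D" for p
  proof -
    have "F p u \<in> ?V" if "u \<in> N (fst p)" for u
      using F[OF \<open>p \<in> D\<close>] that N_subset by (auto simp: bij_betw_def)
    moreover have "fst p \<in> ?V" using that by (auto simp: D_def)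
    ultimately show ?thesis
      using that F[OF that] N_ne N_subset unfolding T_def by (auto simp: D_def)
  qed
  \<comment> \<open>Working on \<open>D\<close> keeps the support of \<open>s\<close> away from the
    diagonal and from adjacent pairs.\<close>
  have "markov_chain_on D T" using T_support by (simp add: markov_chain_on_def)
  then obtain s where s: "set_pmf s \<subseteq> D" "bind_pmf s T = s"
    using stationary_distribution_on_exists[OF finD] ab
    by (auto simp: stationary_distribution_on_def)
  have pos_D: "p \<in> D" if "pmf s p > 0" for p
    using that s(1) by (auto simp: set_pmf_iff)
  have T_fst: "map_pmf fst (T (x, y)) = pmf_of_set (N x)" if "(x, y) \<in> D" for x y
    using that by (simp add: T_def map_pmf_comp)
  have T_snd: "map_pmf snd (T (x, y)) = pmf_of_set (N y)" if "(x, y) \<in> D" for x y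
    using that F[OF that] N_ne[of x]
    by (simp add: T_def map_pmf_comp D_def map_pmf_of_set_bij_betw)
  have T_sub: "set_pmf (T (x, y)) \<subseteq> ?V \<times> ?V" if "(x, y) \<in> D" for x y
    using T_support[OF that] by (auto simp: D_def)
  have unif: "pmf (pmf_of_set (N v)) u = (if v \<rightarrow>\<^bsub>G\<^esub> u then 1 / real (out_degree G v) else 0)"
    if "v \<in> ?V" "u \<in> ?V" for u v
    using that N_ne[of v] card_N[of v] deg[of v] by (auto simp: pmf_of_set N_def[symmetric]) (auto simp: N_def)
  have "markovian_avoidance_process ?V T s"
    unfolding markovian_avoidance_process_def
  proof (intro conjI ballI impI)
    show "markov_chain_on (?V \<times> ?V) T"
      unfolding markov_chain_on_def using T_sub by (auto simp: T_def)
    show "stationary_distribution_on (?V \<times> ?V) T s"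
      using s unfolding stationary_distribution_on_def D_def by auto
    show "pmf s (v, v) = 0" for v
      using s(1) by (auto simp: pmf_eq_0_set_pmf D_def)
    \<comment> \<open>The first token moves to a neighbour of \<open>v\<close>, and \<open>w\<close>
      is not one.\<close>
    show "pmf (T (v, w)) (w, u) = 0" if "pmf s (v, w) > 0" for v w u
    proof -
      have vw: "(v, w) \<in> D" using pos_D[OF that] .
      then show ?thesis
        using N_ne[of v] unfolding pmf_eq_0_set_pmf by (auto simp: T_def D_def)
    qed
  qed
  moreover have "(\<Sum>y'\<in>?V. pmf (T (x, y)) (x', y')) = (if x \<rightarrow>\<^bsub>G\<^esub> x' then 1 / real (out_degree G x) else 0)"
    if "x \<in> ?V" "x' \<in> ?V" "pmf s (x, y) > 0" for x y x'
    using that pos_D by (simp add: sum_pmf_fst[OF _ T_sub] T_fst unif)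
  moreover have "(\<Sum>x'\<in>?V. pmf (T (x, y)) (x', y')) = (if y \<rightarrow>\<^bsub>G\<^esub> y' then 1 / real (out_degree G y) else 0)"
    if "y \<in> ?V" "y' \<in> ?V" "pmf s (x, y) > 0" for x y y'
    using that pos_D by (simp add: sum_pmf_snd[OF _ T_sub] T_snd unif)
  ultimately have "uniform_avoidance_coupling G T s"
    unfolding uniform_avoidance_coupling_def by blast
  then show ?thesis unfolding admits_uniform_avoidance_coupling_def by blast
qed

end
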